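(* Let $(X,S)$ be an $S$-metric space, let $\mathcal{I}$ be an admissible ideal of $\mathbb{N}$ satisfying the condition $(AP)$, and let $\{x_n\}_{n\in\mathbb{N}}$ be an $\mathcal{I}$-localized sequence in $X$ with $\mathcal{I}$-barrier $\sigma$. Then $\{x_n\}_{n\in\mathbb{N}}$ is an $\mathcal{I}$-Cauchy sequence if and only if $\sigma=0$.
   Context: An $S$-metric on a nonempty set $X$ is a function $S:X\times X\times X\to[0,\infty)$ such that for all $x,y,z,a\in X$: (i) $S(x,y,z)\ge 0$; (ii) $S(x,y,z)=0$ if and only if $x=y=z$; (iii) $S(x,y,z)\le S(x,x,a)+S(y,y,a)+S(z,z,a)$. The pair $(X,S)$ is called an $S$-metric space. An ideal $\mathcal{I}$ of $\mathbb{N}$ is a collection of subsets of $\mathbb{N}$ closed under finite unions and under taking subsets; it is non-trivial if it is neither $\{\emptyset\}$ nor $2^{\mathbb{N}}$, and admissible if it is non-trivial and $\{n\}\in\mathcal{I}$ for every $n\in\mathbb{N}$. An admissible ideal $\mathcal{I}$ satisfies the condition $(AP)$ if for every countable family $\{A_1,A_2,\ldots\}$ of sets in $\mathcal{I}$ there is a countable family $\{B_1,B_2,\ldots\}$ of subsets of $\mathbb{N}$ such that $A_i\triangle B_i$ is finite for each $i\in\mathbb{N}$ and $\bigcup_{i\in\mathbb{N}}B_i\in\mathcal{I}$. A real sequence $\{a_n\}_{n\in\mathbb{N}}$ is $\mathcal{I}$-convergent to $a\in\mathbb{R}$, written $\mathcal{I}\text{-}\lim_{n\to\infty}a_n=a$,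 if $\{n\in\mathbb{N}:|a_n-a|\ge\varepsilon\}\in\mathcal{I}$ for every $\varepsilon>0$. A sequence $\{x_n\}$ in $X$ is $\mathcal{I}$-localized in $M\subset X$ if for each $x\in M$ the real sequence $\{S(x_n,x_n,x)\}_{n\in\mathbb{N}}$ is $\mathcal{I}$-convergent. The $\mathcal{I}$-locator $loc_{\mathcal{I}}(x_n)$ is the maximal subset of $X$ on which $\{x_n\}$ is $\mathcal{I}$-localized. "$\mathcal{I}$-localized sequence" without mention of a set means that $\{x_n\}$ is $\mathcal{I}$-localized in some nonempty subset of $X$, i.e. $loc_{\mathcal{I}}(x_n)\neq\emptyset$. The $\mathcal{I}$-barrier of an $\mathcal{I}$-localized sequence $\{x_n\}$ with $L=loc_{\mathcal{I}}(x_n)$ is the number $\sigma=\inf_{x\in L}\left(\mathcal{I}\text{-}\lim_{n\to\infty}S(x_n,x_n,x)\right)$. A sequence $\{x_n\}$ in $X$ is $\mathcal{I}$-Cauchy if for every $\varepsilon>0$ there is a positive integer $n_0=n_0(\varepsilon)$ such that $\{n\in\mathbb{N}:S(x_n,x_n,x_{n_0})\ge\varepsilon\}\in\mathcal{I}$. *)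

theory Defs
  imports Complex_Main
begin

locale S_metric_space =
  fixes X :: "'a set" and S :: "'a \<Rightarrow> 'a \<Rightarrow> 'a \<Rightarrow> real"
  assumes nonempty: "X \<noteq> {}"
    and nonneg: "\<lbrakk>x \<in> X; y \<in> X; z \<in> X\<rbrakk> \<Longrightarrow> 0 \<le> S x y z"
    and zero_iff: "\<lbrakk>x \<in> X; y \<in> X; z \<in> X\<rbrakk> \<Longrightarrow> S x y z = 0 \<longleftrightarrow> x = y \<and> y = z"
    and triangle: "\<lbrakk>x \<in> X; y \<in> X; z \<in> X; a \<in> X\<rbrakk> \<Longrightarrow>
      S x y z \<le> S x x a + S y y a + S z z a"

text \<open>The empty union is included, so every ideal contains the empty set.\<close>

definition nat_ideal :: "nat set set \<Rightarrow> bool" where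
  "nat_ideal I \<longleftrightarrow>
     (\<forall>F. finite F \<and> F \<subseteq> I \<longrightarrow> \<Union>F \<in> I) \<and> (\<forall>A\<in>I. \<forall>B. B \<subseteq> A \<longrightarrow> B \<in> I)"

definition nontrivial_ideal :: "nat set set \<Rightarrow> bool" where
  "nontrivial_ideal I \<longleftrightarrow> nat_ideal I \<and> I \<noteq> {{}} \<and> I \<noteq> UNIV"

definition admissible_ideal :: "nat set set \<Rightarrow> bool" where
  "admissible_ideal I \<longleftrightarrow> nontrivial_ideal I \<and> (\<forall>n. {n} \<in> I)"

definition ideal_AP :: "nat set set \<Rightarrow> bool" where
  "ideal_AP I \<longleftrightarrow>
     (\<forall>A :: nat \<Rightarrow> nat set. (\<forall>i. A i \<in> I) \<longrightarrow>
        (\<exists>B :: nat \<Rightarrow> nat set. (\<forall>i. finite (sym_diff (A i) (B i))) \<and> (\<Union>i. B i) \<in> I))"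

definition ideal_converges :: "nat set set \<Rightarrow> (nat \<Rightarrow> real) \<Rightarrow> real \<Rightarrow> bool" where
  "ideal_converges I a l \<longleftrightarrow> (\<forall>\<epsilon>>0. {n. \<bar>a n - l\<bar> \<ge> \<epsilon>} \<in> I)"

definition ideal_convergent :: "nat set set \<Rightarrow> (nat \<Rightarrow> real) \<Rightarrow> bool" where
  "ideal_convergent I a \<longleftrightarrow> (\<exists>l. ideal_converges I a l)"

definition ideal_lim :: "nat set set \<Rightarrow> (nat \<Rightarrow> real) \<Rightarrow> real" where
  "ideal_lim I a = (THE l. ideal_converges I a l)"

lemma ideal_lim_eqI:
  assumes I: "admissible_ideal I" and l: "ideal_converges I a l"
  shows "ideal_lim I a = l"
  unfolding ideal_lim_def
proof (rule the_equality[where P = "ideal_converges I a", OF l])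
  fix m assume m: "ideal_converges I a m"
  have un: "finite F \<Longrightarrow> F \<subseteq> I \<Longrightarrow> \<Union>F \<in> I"
    and sub: "A \<in> I \<Longrightarrow> B \<subseteq> A \<Longrightarrow> B \<in> I" and ne: "I \<noteq> UNIV" for F A B
    using I by (simp_all add: admissible_ideal_def nontrivial_ideal_def nat_ideal_def)
  show "m = l"
  proof (rule ccontr)
    assume "m \<noteq> l"
    define e where "e = \<bar>m - l\<bar> / 2"
    have "e > 0" using \<open>m \<noteq> l\<close> by (simp add: e_def)
    then have "{n. \<bar>a n - l\<bar> \<ge> e} \<in> I" "{n. \<bar>a n - m\<bar> \<ge> e} \<in> I"
      using l m by (simp_all add: ideal_converges_def)
    then have "\<Union>{{n. \<bar>a n - l\<bar> \<ge> e}, {n. \<bar>a n - m\<bar> \<ge> e}} \<in> I"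
      by (intro un) simp_all
    moreover have "2 * e = \<bar>m - l\<bar>" by (simp add: e_def)
    then have "e \<le> \<bar>b - l\<bar> \<or> \<not> e \<le> \<bar>b - l\<bar> \<and> e \<le> \<bar>b - m\<bar>" for b
      by arith
    then have "\<Union>{{n. \<bar>a n - l\<bar> \<ge> e}, {n. \<bar>a n - m\<bar> \<ge> e}} = UNIV"
      by (simp add: set_eq_iff) blast
    ultimately have "UNIV \<in> I" by simp
    then have "B \<in> I" for B by (rule sub) simp
    then have "I = UNIV" by (simp add: set_eq_iff)
    with ne show False by contradiction
  qed
qed

definition ideal_localized_on ::
  "('a \<Rightarrow> 'a \<Rightarrow> 'a \<Rightarrow> real) \<Rightarrow> nat set set \<Rightarrow> (nat \<Rightarrow> 'a) \<Rightarrow> 'a set \<Rightarrow> bool" where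
  "ideal_localized_on S I x M \<longleftrightarrow> (\<forall>y\<in>M. ideal_convergent I (\<lambda>n. S (x n) (x n) y))"

text \<open>The maximal subset of \<open>X\<close> on which the sequence is localized; see
  \<open>ideal_locator_maximal\<close>.\<close>

definition ideal_locator ::
  "'a set \<Rightarrow> ('a \<Rightarrow> 'a \<Rightarrow> 'a \<Rightarrow> real) \<Rightarrow> nat set set \<Rightarrow> (nat \<Rightarrow> 'a) \<Rightarrow> 'a set" where
  "ideal_locator X S I x = \<Union>{M. M \<subseteq> X \<and> ideal_localized_on S I x M}"

lemma ideal_locator_maximal:
  shows "ideal_locator X S I x \<subseteq> X"
    and "ideal_localized_on S I x (ideal_locator X S I x)"
    and "\<lbrakk>M \<subseteq> X; ideal_localized_on S I x M\<rbrakk> \<Longrightarrow> M \<subseteq> ideal_locator X S I x"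
  unfolding ideal_locator_def ideal_localized_on_def by blast+

definition ideal_localized ::
  "'a set \<Rightarrow> ('a \<Rightarrow> 'a \<Rightarrow> 'a \<Rightarrow> real) \<Rightarrow> nat set set \<Rightarrow> (nat \<Rightarrow> 'a) \<Rightarrow> bool" where
  "ideal_localized X S I x \<longleftrightarrow> (\<exists>M. M \<subseteq> X \<and> M \<noteq> {} \<and> ideal_localized_on S I x M)"

lemma ideal_localized_iff: "ideal_localized X S I x \<longleftrightarrow> ideal_locator X S I x \<noteq> {}"
  unfolding ideal_localized_def ideal_locator_def by blast

text \<open>For a localized sequence in an \<open>S\<close>-metric space and an admissible ideal this is an infimum
  of a nonempty set of nonnegative reals, each a genuine limit by \<open>ideal_lim_eqI\<close>.\<close>

definition ideal_barrier ::
  "'a set \<Rightarrow> ('a \<Rightarrow> 'a \<Rightarrow> 'a \<Rightarrow> real) \<Rightarrow> nat set set \<Rightarrow> (nat \<Rightarrow> 'a) \<Rightarrow> real" where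
  "ideal_barrier X S I x = (INF y\<in>ideal_locator X S I x. ideal_lim I (\<lambda>n. S (x n) (x n) y))"

text \<open>The natural numbers are rendered by the type \<open>nat\<close>, which starts at 0. For an admissible
  ideal on an \<open>S\<close>-metric space, requiring \<open>n0 > 0\<close> or not yields the same notion.\<close>

definition ideal_Cauchy ::
  "('a \<Rightarrow> 'a \<Rightarrow> 'a \<Rightarrow> real) \<Rightarrow> nat set set \<Rightarrow> (nat \<Rightarrow> 'a) \<Rightarrow> bool" where
  "ideal_Cauchy S I x \<longleftrightarrow> (\<forall>\<epsilon>>0. \<exists>n0>0. {n. S (x n) (x n) (x n0) \<ge> \<epsilon>} \<in> I)"

end

(* Write d(u,v) = S(u,u,v). The axioms make d symmetric with d(u,v) \<le> 2 d(u,a) + d(v,a), hence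
   |d(u,y) - d(v,y)| \<le> 2 d(u,v). So if (x_n) is I-Cauchy, each real sequence d(x_n,y) is I-Cauchy
   and therefore I-convergent; every x_m then lies in the locator, and the I-limit of d(x_n,x_{n0})
   is at most \<epsilon>, which forces the barrier to be 0. Conversely, if some y has I-lim d(x_n,y) < \<epsilon>/3,
   any index n0 with d(x_{n0},y) < \<epsilon>/3 witnesses the Cauchy condition for \<epsilon>. *)
theory Submission
  imports Defs
begin

context
  fixes I :: "nat set set"
  assumes I: "admissible_ideal I"
begin

lemma admissible_ideal_subset: "A \<in> I \<Longrightarrow> B \<subseteq> A \<Longrightarrow> B \<in> I"
  using I by (simp add: admissible_ideal_def nontrivial_ideal_def nat_ideal_def)

lemma admissible_ideal_Un:
  assumes "A \<in> I" "B \<in> I"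
  shows "A \<union> B \<in> I"
proof -
  have "\<forall>F. finite F \<and> F \<subseteq> I \<longrightarrow> \<Union>F \<in> I"
    using I by (simp add: admissible_ideal_def nontrivial_ideal_def nat_ideal_def)
  from this[rule_format, of "{A, B}"] have "\<Union>{A, B} \<in> I"
    using assms by simp
  then show ?thesis by simp
qed

lemma admissible_ideal_UNIV: "UNIV \<notin> I"
proof
  assume "UNIV \<in> I"
  then have "I = UNIV" using admissible_ideal_subset by blast
  with I show False by (simp add: admissible_ideal_def nontrivial_ideal_def)
qed

lemma admissible_ideal_singleton: "{n} \<in> I"
  using I by (simp add: admissible_ideal_def)

text \<open>Two sets of \<open>I\<close> cannot cover all indices, since their union is again in
  \<open>I\<close>. This lets two properties that hold outside sets of \<open>I\<close> be evaluated
  at one common index.\<close>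

lemma admissible_ideal_ex_avoid2:
  assumes "A \<in> I" "B \<in> I"
  shows "\<exists>n. n \<notin> A \<and> n \<notin> B"
proof -
  have "A \<union> B \<noteq> UNIV"
    using admissible_ideal_Un[OF assms] admissible_ideal_UNIV by metis
  then show ?thesis by blast
qed

text \<open>Completeness of the reals, transferred to ideals: the centre \<open>c\<close> may vary
  with \<open>e\<close>, and the limit is obtained as a supremum.\<close>

lemma ideal_convergent_if_Cauchy:
  assumes cau: "\<And>e. e > 0 \<Longrightarrow> \<exists>c. {n. \<bar>a n - c\<bar> \<ge> e} \<in> I"
  shows "ideal_convergent I a"
proof -
  \<comment> \<open>\<open>Sup T\<close> is the limit inferior of \<open>a\<close> along
    \<open>I\<close>. The next two facts trap it between \<open>c - e\<close> and
    \<open>c + e\<close> for every admissible pair \<open>c\<close>, \<open>e\<close>.\<close>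
  define T where "T = {t. {n. a n < t} \<in> I}"
  have lower: "c - e \<in> T" if "{n. \<bar>a n - c\<bar> \<ge> e} \<in> I" for c e
    unfolding T_def mem_Collect_eq by (rule admissible_ideal_subset[OF that]) auto
  have upper: "t \<le> c + e" if c: "{n. \<bar>a n - c\<bar> \<ge> e} \<in> I" and t: "t \<in> T" for c e t
  proof -
    have "{n. a n < t} \<in> I" using t by (simp add: T_def)
    from admissible_ideal_ex_avoid2[OF c this]
    obtain n where "\<bar>a n - c\<bar> < e" "t \<le> a n" by (auto simp: not_le not_less)
    then show ?thesis by linarith
  qed
  have "ideal_converges I a (Sup T)"
    unfolding ideal_converges_def
  proof (intro allI impI)
    fix e :: real
    assume "e > 0"
    then obtain c where c: "{n. \<bar>a n - c\<bar> \<ge> e / 2} \<in> I"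
      using cau[of "e / 2"] by auto
    have "c - e / 2 \<le> Sup T"
      using lower[OF c] upper[OF c] by (intro cSup_upper bdd_aboveI)
    moreover have "Sup T \<le> c + e / 2"
      using lower[OF c] upper[OF c] by (intro cSup_least) auto
    ultimately have "\<bar>a n - c\<bar> \<ge> e / 2" if "\<bar>a n - Sup T\<bar> \<ge> e" for n
      using that by linarith
    then show "{n. \<bar>a n - Sup T\<bar> \<ge> e} \<in> I"
      by (intro admissible_ideal_subset[OF c] Collect_mono impI)
  qed
  then show ?thesis by (auto simp: ideal_convergent_def)
qed

lemma ideal_converges_le:
  assumes l: "ideal_converges I a l" and b: "{n. a n > b} \<in> I"
  shows "l \<le> b"
proof (rule ccontr)
  assume "\<not> l \<le> b"
  then have "{n. \<bar>a n - l\<bar> \<ge> l - b} \<in> I" using l by (simp add: ideal_converges_def)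
  from admissible_ideal_ex_avoid2[OF this b]
  obtain n where "\<bar>a n - l\<bar> < l - b" "a n \<le> b" by (auto simp: not_le not_less)
  then show False by linarith
qed

lemma ideal_converges_ge:
  assumes l: "ideal_converges I a l" and b: "{n. a n < b} \<in> I"
  shows "b \<le> l"
proof (rule ccontr)
  assume "\<not> b \<le> l"
  then have "{n. \<bar>a n - l\<bar> \<ge> b - l} \<in> I" using l by (simp add: ideal_converges_def)
  from admissible_ideal_ex_avoid2[OF this b]
  obtain n where "\<bar>a n - l\<bar> < b - l" "b \<le> a n" by (auto simp: not_le not_less)
  then show False by linarith
qed

lemma ideal_converges_lim: "ideal_convergent I a \<Longrightarrow> ideal_converges I a (ideal_lim I a)"
  using ideal_lim_eqI[OF I] by (auto simp: ideal_convergent_def)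

end

lemma mem_ideal_locator_iff:
  "y \<in> ideal_locator X S I x \<longleftrightarrow> y \<in> X \<and> ideal_convergent I (\<lambda>n. S (x n) (x n) y)"
  unfolding ideal_locator_def ideal_localized_on_def by blast

context S_metric_space
begin

lemma S_refl: "u \<in> X \<Longrightarrow> S u u u = 0"
  by (simp add: zero_iff)

text \<open>Choosing the auxiliary point equal to the repeated argument makes two of the three terms
  on the right vanish, which leaves one inequality; the other follows by exchanging \<open>u\<close>
  and \<open>v\<close>.\<close>

lemma S_sym: "u \<in> X \<Longrightarrow> v \<in> X \<Longrightarrow> S u u v = S v v u"
  using triangle[of u u v u] triangle[of v v u v] by (simp add: S_refl)

lemma S_diff_le:
  assumes "u \<in> X" "v \<in> X" "y \<in> X"
  shows "\<bar>S u u y - S v v y\<bar> \<le> 2 * S u u v"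
  using triangle[of u u y v] triangle[of v v y u]
    S_sym[of v u] S_sym[of y u] S_sym[of y v] assms by simp

lemma ideal_Cauchy_imp_convergent:
  assumes I: "admissible_ideal I" and x: "\<And>n. x n \<in> X"
    and cau: "ideal_Cauchy S I x" and y: "y \<in> X"
  shows "ideal_convergent I (\<lambda>n. S (x n) (x n) y)"
proof (rule ideal_convergent_if_Cauchy[OF I])
  fix e :: real
  assume "e > 0"
  \<comment> \<open>Half of \<open>e\<close> absorbs the factor 2 of \<open>S_diff_le\<close>; the
    centre will be \<open>S (x m) (x m) y\<close>.\<close>
  then obtain m where m: "{n. S (x n) (x n) (x m) \<ge> e / 2} \<in> I"
    using cau unfolding ideal_Cauchy_def by (meson half_gt_zero)
  have "{n. \<bar>S (x n) (x n) y - S (x m) (x m) y\<bar> \<ge> e} \<in> I"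
  proof (rule admissible_ideal_subset[OF I m], clarify)
    fix n assume "e \<le> \<bar>S (x n) (x n) y - S (x m) (x m) y\<bar>"
    then show "e / 2 \<le> S (x n) (x n) (x m)"
      using S_diff_le[OF x[of n] x[of m] y] by linarith
  qed
  then show "\<exists>c. {n. \<bar>S (x n) (x n) y - c\<bar> \<ge> e} \<in> I" ..
qed

lemma ideal_lim_nonneg:
  assumes I: "admissible_ideal I" and x: "\<And>n. x n \<in> X"
    and y: "y \<in> ideal_locator X S I x"
  shows "0 \<le> ideal_lim I (\<lambda>n. S (x n) (x n) y)"
proof -
  have yX: "y \<in> X" and conv: "ideal_convergent I (\<lambda>n. S (x n) (x n) y)"
    using y by (simp_all add: mem_ideal_locator_iff)
  have "{n. S (x n) (x n) y < 0} = {}"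
    using nonneg[OF x x yX] by (simp add: not_less)
  then have "{n. S (x n) (x n) y < 0} \<in> I"
    using admissible_ideal_subset[OF I admissible_ideal_singleton[OF I, of 0]] by simp
  then show ?thesis
    by (rule ideal_converges_ge[OF I ideal_converges_lim[OF I conv]])
qed

end

theorem theorem3p5:
  fixes X :: "'a set" and S :: "'a \<Rightarrow> 'a \<Rightarrow> 'a \<Rightarrow> real"
    and I :: "nat set set" and x :: "nat \<Rightarrow> 'a" and \<sigma> :: real
  assumes "S_metric_space X S"
    and "admissible_ideal I"
    and "ideal_AP I"
    and "\<forall>n. x n \<in> X"
    and "ideal_localized X S I x"
    and "\<sigma> = ideal_barrier X S I x"
  shows "ideal_Cauchy S I x \<longleftrightarrow> \<sigma> = 0"
proof -
  interpret S_metric_space X S by fact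
  note I = \<open>admissible_ideal I\<close>
  have x: "x n \<in> X" for n using assms(4) by simp
  define L where "L = ideal_locator X S I x"
  define f where "f y = ideal_lim I (\<lambda>n. S (x n) (x n) y)" for y
  have \<sigma>: "\<sigma> = (INF y\<in>L. f y)"
    using assms(6) by (simp add: ideal_barrier_def L_def f_def)
  have L: "L \<noteq> {}" using assms(5) by (simp add: ideal_localized_iff L_def)
  have f0: "0 \<le> f y" if "y \<in> L" for y
    using ideal_lim_nonneg[where x = x, OF I x] that by (simp add: L_def f_def)
  \<comment> \<open>An infimum of reals obeys the usual rules only for nonempty sets that are
    bounded below.\<close>
  have bdd: "bdd_below (f ` L)" using f0 by (intro bdd_belowI2)
  have conv: "ideal_converges I (\<lambda>n. S (x n) (x n) y) (f y)" and LX: "y \<in> X" if "y \<in> L" for y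
    using that ideal_converges_lim[OF I] by (simp_all add: mem_ideal_locator_iff L_def f_def)
  show ?thesis
  proof
    assume cau: "ideal_Cauchy S I x"
    have "\<sigma> \<le> 0 + e" if e: "e > 0" for e
    proof -
      obtain m where m: "{n. S (x n) (x n) (x m) \<ge> e} \<in> I"
        using cau e unfolding ideal_Cauchy_def by blast
      have mL: "x m \<in> L"
        unfolding L_def mem_ideal_locator_iff
        using ideal_Cauchy_imp_convergent[where x = x, OF I x cau x] x by blast
      have "{n. S (x n) (x n) (x m) > e} \<in> I"
        by (rule admissible_ideal_subset[OF I m]) auto
      then have "f (x m) \<le> e" by (rule ideal_converges_le[OF I conv[OF mL]])
      moreover have "\<sigma> \<le> f (x m)" unfolding \<sigma> by (rule cINF_lower[OF bdd mL])
      ultimately show ?thesis by simp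
    qed
    then have "\<sigma> \<le> 0" by (rule field_le_epsilon)
    moreover have "0 \<le> \<sigma>" unfolding \<sigma> using L f0 by (rule cINF_greatest)
    ultimately show "\<sigma> = 0" by simp
  next
    assume "\<sigma> = 0"
    show "ideal_Cauchy S I x"
      unfolding ideal_Cauchy_def
    proof (intro allI impI)
      fix e :: real
      assume e: "e > 0"
      then have "(INF y\<in>L. f y) < e / 3" using \<open>\<sigma> = 0\<close> \<sigma> by simp
      then obtain y where y: "y \<in> L" "f y < e / 3"
        using cINF_less_iff[OF L bdd] by blast
      define A where "A = {n. S (x n) (x n) y \<ge> e / 3}"
      \<comment> \<open>The radius \<open>e / 3 - f y\<close> is positive and reaches from the limit
        \<open>f y\<close> up to the threshold \<open>e / 3\<close> in \<open>A\<close>.\<close>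
      have "{n. \<bar>S (x n) (x n) y - f y\<bar> \<ge> e / 3 - f y} \<in> I"
        using conv[OF y(1)] y(2) by (simp add: ideal_converges_def)
      then have A: "A \<in> I"
        by (rule admissible_ideal_subset[OF I]) (auto simp: A_def)
      \<comment> \<open>Avoiding \<open>{0}\<close> as well as \<open>A\<close> gives the positive
        index that \<open>ideal_Cauchy\<close> asks for.\<close>
      from admissible_ideal_ex_avoid2[OF I A admissible_ideal_singleton[OF I, of 0]]
      obtain m where m: "m > 0" "S (x m) (x m) y < e / 3"
        by (auto simp: A_def not_le)
      have "{n. S (x n) (x n) (x m) \<ge> e} \<subseteq> A"
      proof (unfold A_def, clarify)
        fix n assume "e \<le> S (x n) (x n) (x m)"
        then show "e / 3 \<le> S (x n) (x n) y"
          \<comment> \<open>Through \<open>y\<close>, the value \<open>S (x n) (x n) (x m)\<close>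
            is at most twice \<open>S (x n) (x n) y\<close> plus \<open>S (x m) (x m) y\<close>:
            three terms, hence the thirds of \<open>e\<close>.\<close>
          using triangle[OF x[of n] x[of n] x[of m] LX[OF y(1)]] m(2) by linarith
      qed
      with A have "{n. S (x n) (x n) (x m) \<ge> e} \<in> I"
        by (rule admissible_ideal_subset[OF I])
      with m(1) show "\<exists>m>0. {n. S (x n) (x n) (x m) \<ge> e} \<in> I" by blast
    qed
  qed
qed

end
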